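(* For every $n \ge 1$, the monoid $U_n(\mathbb{T})$ of $n \times n$ upper-triangular tropical matrices satisfies the identity $u_{n-1}(xy,yx) = v_{n-1}(xy,yx)$.
   Context: The tropical semiring is $\mathbb{T} = \mathbb{R} \cup \{-\infty\}$ with addition $x \oplus y = \max\{x,y\}$ and multiplication $x \otimes y = x + y$. $U_n(\mathbb{T})$ denotes the monoid (under tropical matrix multiplication) of $n \times n$ upper-triangular tropical matrices, i.e. matrices over $\mathbb{T}$ all of whose entries below the main diagonal equal $-\infty$. Words in two variables $p,q$ are defined by $u_0(p,q) = p$, $v_0(p,q) = q$, $u_1(p,q) = pqppq$, $v_1(p,q) = pqqpq$, and for $m \ge 2$ inductively $u_m(p,q) = u_1(u_{m-1}(p,q), v_{m-1}(p,q))$ and $v_m(p,q) = v_1(u_{m-1}(p,q), v_{m-1}(p,q))$. Then $u_{n-1}(xy,yx)$ and $v_{n-1}(xy,yx)$ are words in variables $x,y$ obtained by substituting $p = xy$, $q = yx$. A monoid satisfies an identity $w = w'$ if the equality holds under every substitution of the variables by elements of the monoid. *)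

theory Defs
  imports Jordan_Normal_Form.Matrix "HOL-Library.Extended_Real"
begin

text \<open>The tropical (max-plus) semiring on the reals with minus infinity. As a semiring,
  its zero is minus infinity and its one is the real number 0.\<close>

typedef trop = "{x :: ereal. x \<noteq> \<infinity>}"
  morphisms ereal_of_trop Trop
  by (rule exI[of _ 0]) simp

setup_lifting type_definition_trop

instantiation trop :: comm_semiring_1
begin

lift_definition zero_trop :: trop is "- \<infinity>" by simp

lift_definition one_trop :: trop is "0" by simp

lift_definition plus_trop :: "trop \<Rightarrow> trop \<Rightarrow> trop" is "max" by (simp add: max_def)

lift_definition times_trop :: "trop \<Rightarrow> trop \<Rightarrow> trop" is "(+)" by simp

instance
proof
  fix a b c :: trop
  show "a * b * c = a * (b * c)" by transfer (simp add: add.assoc)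
  show "a * b = b * a" by transfer (simp add: add.commute)
  show "1 * a = a" by transfer simp
  show "a + b + c = a + (b + c)" by transfer (simp add: max.assoc)
  show "a + b = b + a" by transfer (simp add: max.commute)
  show "0 + a = a" by transfer simp
  show "0 * a = 0" by transfer simp
  show "a * 0 = 0" by transfer simp
  show "(0 :: trop) \<noteq> 1" by transfer simp
  show "(a + b) * c = a * c + b * c"
  proof transfer
    fix a b c :: ereal
    show "max a b + c = max (a + c) (b + c)"
      by (cases "a \<le> b") (simp_all add: max_def add_right_mono antisym)
  qed
qed

end

text \<open>Tropical matrix multiplication is the library's matrix multiplication over this semiring,
  and \<^const>\<open>upper_triangular\<close> requires the entries below the diagonal to be the semiring
  zero, that is, minus infinity.\<close>

definition UT :: "nat \<Rightarrow> trop mat monoid" where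
  "UT n = \<lparr>carrier = {A \<in> carrier_mat n n. upper_triangular A}, mult = (*), one = 1\<^sub>m n\<rparr>"

lemma monoid_UT: "monoid (UT n)"
proof (rule monoidI)
  fix A B assume A: "A \<in> carrier (UT n)" and B: "B \<in> carrier (UT n)"
  then have dims: "A \<in> carrier_mat n n" "B \<in> carrier_mat n n"
    and tri: "upper_triangular A" "upper_triangular B"
    by (auto simp: UT_def)
  have "(A * B) $$ (i, j) = 0" if "i < n" "j < i" for i j
  proof -
    have "A $$ (i, k) * B $$ (k, j) = 0" if "k < n" for k
    proof (cases "k < i")
      case True
      then show ?thesis using tri(1) dims \<open>i < n\<close> by (auto simp: upper_triangular_def)
    next
      case False
      then show ?thesis using tri(2) dims \<open>k < n\<close> \<open>j < i\<close> by (auto simp: upper_triangular_def)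
    qed
    then show ?thesis using dims that by (auto simp: scalar_prod_def intro!: sum.neutral)
  qed
  then show "A \<otimes>\<^bsub>UT n\<^esub> B \<in> carrier (UT n)"
    using dims by (auto simp: UT_def upper_triangular_def)
next
  show "\<one>\<^bsub>UT n\<^esub> \<in> carrier (UT n)" by (auto simp: UT_def upper_triangular_def)
qed (auto simp: UT_def intro: assoc_mult_mat left_mult_one_mat right_mult_one_mat)

text \<open>Words over an alphabet are lists of letters, and concatenation is the product.
  The words u_m(p, q) and v_m(p, q) are defined directly for arbitrary words p and q, so that
  substituting for the two variables is function application.\<close>

definition u1_word :: "'a list \<Rightarrow> 'a list \<Rightarrow> 'a list" where
  "u1_word p q = p @ q @ p @ p @ q"

definition v1_word :: "'a list \<Rightarrow> 'a list \<Rightarrow> 'a list" where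
  "v1_word p q = p @ q @ q @ p @ q"

fun u_word v_word :: "nat \<Rightarrow> 'a list \<Rightarrow> 'a list \<Rightarrow> 'a list" where
  "u_word 0 p q = p"
| "u_word (Suc m) p q = u1_word (u_word m p q) (v_word m p q)"
| "v_word 0 p q = q"
| "v_word (Suc m) p q = v1_word (u_word m p q) (v_word m p q)"

lemma "u_word 1 p q = u1_word p q" "v_word 1 p q = v1_word p q"
  by simp_all

definition eval_word :: "('b, 'm) monoid_scheme \<Rightarrow> ('a \<Rightarrow> 'b) \<Rightarrow> 'a list \<Rightarrow> 'b" where
  "eval_word M \<sigma> w = foldr (\<lambda>a b. \<sigma> a \<otimes>\<^bsub>M\<^esub> b) w \<one>\<^bsub>M\<^esub>"

definition satisfies_identity :: "('b, 'm) monoid_scheme \<Rightarrow> 'a list \<Rightarrow> 'a list \<Rightarrow> bool" where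
  "satisfies_identity M w w' \<longleftrightarrow>
    (\<forall>\<sigma>. range \<sigma> \<subseteq> carrier M \<longrightarrow> eval_word M \<sigma> w = eval_word M \<sigma> w')"

datatype var = X | Y

end

theory Submission imports Defs begin

text \<open>The matrices of \<open>xy\<close> and \<open>yx\<close> have the same diagonal, and inductively the matrices
  \<open>P\<close> of \<open>u\<^sub>m(xy,yx)\<close> and \<open>Q\<close> of \<open>v\<^sub>m(xy,yx)\<close> agree at all positions \<open>(i,j)\<close> with
  \<open>j \<le> i + m\<close>. The products \<open>PQPPQ\<close> and \<open>PQQPQ\<close> differ only in their middle factor, so at
  \<open>j = i + m + 1\<close> the only path from \<open>i\<close> to \<open>j\<close> that can distinguish them loops twice at \<open>i\<close>,
  jumps to \<open>j\<close> in the middle factor and loops twice at \<open>j\<close>. In the other product the same jump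
  is available both before and after the middle; moving it towards the end if the loop
  at \<open>i\<close> is the heavier one, and towards the start otherwise, does not decrease the weight.\<close>

section \<open>The order of the tropical semiring\<close>

instantiation trop :: linorder
begin

lift_definition less_eq_trop :: "trop \<Rightarrow> trop \<Rightarrow> bool" is "(\<le>)" .

lift_definition less_trop :: "trop \<Rightarrow> trop \<Rightarrow> bool" is "(<)" .

instance
  by standard (transfer; auto)+

end

text \<open>Since addition is the maximum, \<open>b\<close> itself serves as the witness
  \<open>c\<close>. The class makes \<open>0\<close> (minus infinity) the least element, so the
  nonnegativity conditions of \<open>mult_mono\<close> and \<open>member_le_sum\<close> become
  trivial.\<close>

instance trop :: canonically_ordered_monoid_add
proof
  fix a b :: trop
  show "a \<le> b \<longleftrightarrow> (\<exists>c. b = a + c)"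
    by transfer (auto simp: max_def)
qed

instance trop :: ordered_comm_semiring
proof
  fix a b c :: trop
  assume "a \<le> b"
  then show "c * a \<le> c * b"
    by transfer (rule add_left_mono)
qed

lemma trop_mult_mono:
  fixes a b c d :: trop
  assumes "a \<le> b" and "c \<le> d"
  shows "a * c \<le> b * d"
  using assms by (intro mult_mono) simp_all

text \<open>A sum is a maximum, and an empty or infinite sum is \<open>0\<close>, the least
  element.\<close>

lemma trop_sum_le:
  fixes f :: "'a \<Rightarrow> trop"
  assumes "\<And>k. k \<in> S \<Longrightarrow> f k \<le> c"
  shows "sum f S \<le> c"
  using assms
proof (induction S rule: infinite_finite_induct)
  case (insert x F)
  have "a + b \<le> c" if "a \<le> c" "b \<le> c" for a b :: trop
    using that by transfer simp
  with insert show ?case by simp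
qed simp_all

section \<open>Matrix products as maximal path weights\<close>

lemma index_mult_mat_sum:
  assumes "A \<in> carrier_mat n n" "B \<in> carrier_mat n n" "i < n" "j < n"
  shows "(A * B) $$ (i, j) = (\<Sum>k<n. A $$ (i, k) * B $$ (k, j))"
  using assms by (simp add: scalar_prod_def atLeast0LessThan)

text \<open>The maximum over all paths dominates the path through \<open>k\<close>. Taking lower
  bounds \<open>a\<close> and \<open>b\<close> in place of the entries lets the rule be chained
  through nested products.\<close>

lemma trop_entry_le_mult_mat:
  fixes A B :: "trop mat"
  assumes "A \<in> carrier_mat n n" "B \<in> carrier_mat n n" "i < n" "k < n" "j < n"
    and "a \<le> A $$ (i, k)" and "b \<le> B $$ (k, j)"
  shows "a * b \<le> (A * B) $$ (i, j)"
proof -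
  have "a * b \<le> A $$ (i, k) * B $$ (k, j)"
    using assms by (intro trop_mult_mono)
  also have "\<dots> \<le> (\<Sum>k<n. A $$ (i, k) * B $$ (k, j))"
    using assms by (intro member_le_sum) auto
  finally show ?thesis
    unfolding index_mult_mat_sum[OF assms(1,2,3,5)] .
qed

lemma trop_path_le_mult_mat5:
  fixes A B C D E :: "trop mat"
  assumes "A \<in> carrier_mat n n" "B \<in> carrier_mat n n" "C \<in> carrier_mat n n"
    "D \<in> carrier_mat n n" "E \<in> carrier_mat n n"
    and "i < n" "k1 < n" "k2 < n" "k3 < n" "k4 < n" "j < n"
  shows "A $$ (i, k1) * (B $$ (k1, k2) * (C $$ (k2, k3) * (D $$ (k3, k4) * E $$ (k4, j))))
    \<le> (A * (B * (C * (D * E)))) $$ (i, j)"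
proof -
  have DE: "D * E \<in> carrier_mat n n" and CDE: "C * (D * E) \<in> carrier_mat n n"
    and BCDE: "B * (C * (D * E)) \<in> carrier_mat n n"
    using assms by simp_all
  note step = trop_entry_le_mult_mat[OF _ _ _ _ _ order_refl]
  show ?thesis
    by (rule step[OF assms(1) BCDE assms(6,7,11)], rule step[OF assms(2) CDE assms(7,8,11)],
        rule step[OF assms(3) DE assms(8,9,11)], rule step[OF assms(4,5,9,10,11) order_refl])
qed

lemma trop_mult_mat_le:
  fixes A B :: "trop mat"
  assumes "A \<in> carrier_mat n n" "B \<in> carrier_mat n n" "i < n" "j < n"
    and "\<And>k. k < n \<Longrightarrow> A $$ (i, k) * B $$ (k, j) \<le> c"
  shows "(A * B) $$ (i, j) \<le> c"
  unfolding index_mult_mat_sum[OF assms(1-4)] using assms(5) by (intro trop_sum_le) simp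

section \<open>Upper-triangular matrices and the exchange of a middle factor\<close>

lemma carrier_UT_iff: "A \<in> carrier (UT n) \<longleftrightarrow> A \<in> carrier_mat n n \<and> upper_triangular A"
  by (simp add: UT_def)

lemma mult_UT [simp]: "A \<otimes>\<^bsub>UT n\<^esub> B = A * B"
  by (simp add: UT_def)

lemma mult_carrier_UT:
  "A \<in> carrier (UT n) \<Longrightarrow> B \<in> carrier (UT n) \<Longrightarrow> A * B \<in> carrier (UT n)"
  using monoid.m_closed[OF monoid_UT] by simp

lemma UT_entry_zero:
  "A \<in> carrier (UT n) \<Longrightarrow> i < n \<Longrightarrow> j < i \<Longrightarrow> A $$ (i, j) = 0"
  by (auto simp: carrier_UT_iff)

text \<open>A path from \<open>i\<close> to \<open>i\<close> that leaves \<open>i\<close> uses an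
  entry below the diagonal in one of the factors.\<close>

lemma UT_mult_diag:
  assumes "A \<in> carrier (UT n)" "B \<in> carrier (UT n)" "i < n"
  shows "(A * B) $$ (i, i) = A $$ (i, i) * B $$ (i, i)"
proof -
  have "A $$ (i, k) * B $$ (k, i) = 0" if "k < n" "k \<noteq> i" for k
    using UT_entry_zero[OF assms(1,3), of k] UT_entry_zero[OF assms(2) that(1), of i] that
    by (cases "k < i") auto
  then have "(\<Sum>k<n. A $$ (i, k) * B $$ (k, i)) = (\<Sum>k\<in>{i}. A $$ (i, k) * B $$ (k, i))"
    using assms(3) by (intro sum.mono_neutral_right) auto
  then show ?thesis
    using assms index_mult_mat_sum[of A n B i i] by (simp add: carrier_UT_iff)
qed

text \<open>Each entry is a maximum over paths from \<open>i\<close> via \<open>k\<close> and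
  \<open>l\<close> to \<open>j\<close>. Only those with \<open>i \<le> k\<close> and
  \<open>l \<le> j\<close> can be nonzero, and all of these except the corner path have the same
  weight with \<open>Q\<close> in the middle. So it remains to dominate the corner path, which is
  the hypothesis \<open>corner\<close>.\<close>

lemma UT_middle_factor_le:
  assumes car: "L \<in> carrier (UT n)" "P \<in> carrier (UT n)" "Q \<in> carrier (UT n)" "R \<in> carrier (UT n)"
    and ij: "i < n" "j < n"
    and agree: "\<And>k l. k < n \<Longrightarrow> i \<le> k \<Longrightarrow> l \<le> j \<Longrightarrow> (k, l) \<noteq> (i, j) \<Longrightarrow> P $$ (k, l) = Q $$ (k, l)"
    and corner: "L $$ (i, i) * (P $$ (i, j) * R $$ (j, j)) \<le> (L * (Q * R)) $$ (i, j)"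
  shows "(L * (P * R)) $$ (i, j) \<le> (L * (Q * R)) $$ (i, j)"
proof -
  have mats: "L \<in> carrier_mat n n" "P \<in> carrier_mat n n" "Q \<in> carrier_mat n n" "R \<in> carrier_mat n n"
    "P * R \<in> carrier_mat n n" "Q * R \<in> carrier_mat n n"
    using car by (auto simp: carrier_UT_iff)
  have path: "L $$ (i, k) * (P $$ (k, l) * R $$ (l, j)) \<le> (L * (Q * R)) $$ (i, j)"
    if "k < n" "l < n" for k l
  proof (cases "k < i \<or> j < l")
    case True
    then have "L $$ (i, k) = 0 \<or> R $$ (l, j) = 0"
      using UT_entry_zero[OF car(1) ij(1)] UT_entry_zero[OF car(4) that(2)] by blast
    then show ?thesis by auto
  next
    case False
    show ?thesis
    proof (cases "(k, l) = (i, j)")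
      case True
      then show ?thesis using corner by simp
    next
      case neq: False
      then have "P $$ (k, l) = Q $$ (k, l)"
        using False that by (intro agree) auto
      moreover have "L $$ (i, k) * (Q $$ (k, l) * R $$ (l, j)) \<le> (L * (Q * R)) $$ (i, j)"
        by (intro trop_entry_le_mult_mat[OF mats(1,6) ij(1) that(1) ij(2)]
            trop_entry_le_mult_mat[OF mats(3,4) that ij(2)] order_refl)
      ultimately show ?thesis
        by simp
    qed
  qed
  show ?thesis
  proof (rule trop_mult_mat_le[OF mats(1,5) ij])
    fix k assume "k < n"
    \<comment> \<open>Distributivity splits the weight into single paths, so that
      \<open>path\<close> applies to each term.\<close>
    have "L $$ (i, k) * (P * R) $$ (k, j) = (\<Sum>l<n. L $$ (i, k) * (P $$ (k, l) * R $$ (l, j)))"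
      by (simp only: index_mult_mat_sum[OF mats(2,4) \<open>k < n\<close> ij(2)] sum_distrib_left)
    also have "\<dots> \<le> (L * (Q * R)) $$ (i, j)"
      using path[OF \<open>k < n\<close>] by (intro trop_sum_le) simp
    finally show "L $$ (i, k) * (P * R) $$ (k, j) \<le> (L * (Q * R)) $$ (i, j)" .
  qed
qed

text \<open>One more superdiagonal of agreement. The bracketing isolates the middle factor, the only
  one in which the two products differ.\<close>

lemma UT_agree_step:
  fixes P Q :: "trop mat"
  assumes P: "P \<in> carrier (UT n)" and Q: "Q \<in> carrier (UT n)"
    and agree: "\<And>i j. i < n \<Longrightarrow> j < n \<Longrightarrow> j \<le> i + m \<Longrightarrow> P $$ (i, j) = Q $$ (i, j)"
    and ij: "i < n" "j < n" "j \<le> Suc (i + m)"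
  shows "((P * Q) * (P * (P * Q))) $$ (i, j) = ((P * Q) * (Q * (P * Q))) $$ (i, j)"
proof -
  define d where "d = P $$ (i, i)"
  define e where "e = P $$ (j, j)"
  have diag: "P $$ (i, i) = d" "Q $$ (i, i) = d" "P $$ (j, j) = e" "Q $$ (j, j) = e"
    using agree[of i i] agree[of j j] ij by (simp_all add: d_def e_def)
  have PQ: "P * Q \<in> carrier (UT n)"
    using P Q by (rule mult_carrier_UT)
  have PQ_diag: "(P * Q) $$ (i, i) = d * d" "(P * Q) $$ (j, j) = e * e"
    using UT_mult_diag[OF P Q] ij diag by simp_all
  have mats: "P \<in> carrier_mat n n" "Q \<in> carrier_mat n n"
    using P Q by (simp_all add: carrier_UT_iff)
  have assoc: "(P * Q) * (C * (P * Q)) = P * (Q * (C * (P * Q)))" if "C \<in> carrier_mat n n" for C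
    using that mats by (intro assoc_mult_mat) auto
  \<comment> \<open>From \<open>l \<le> j \<le> i + m + 1 \<le> k + m + 1\<close>, the value
    \<open>l = k + m + 1\<close> would force \<open>k = i\<close> and \<open>l = j\<close>; hence
    \<open>l \<le> k + m\<close>.\<close>
  have off_corner: "P $$ (k, l) = Q $$ (k, l)" if "k < n" "i \<le> k" "l \<le> j" "(k, l) \<noteq> (i, j)" for k l
    using that ij by (intro agree) auto
  show ?thesis
  proof (rule antisym)
    define x where "x = P $$ (i, j)"
    \<comment> \<open>The weight \<open>x\<close> is available only in the factors \<open>P\<close>,
      the first and the fourth of \<open>PQQPQ\<close>. Jumping in the fourth turns one
      \<open>e\<close> into \<open>d\<close>; jumping in the first turns both \<open>d\<close> into
      \<open>e\<close>.\<close>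
    have "(d * d) * (x * (e * e)) \<le> (P * (Q * (Q * (P * Q)))) $$ (i, j)"
    proof (cases "e \<le> d")
      case True
      have "(d * d) * (x * (e * e)) = (d * (d * (x * e))) * e"
        by (simp add: ac_simps)
      also have "\<dots> \<le> (d * (d * (x * e))) * d"
        using True by (intro trop_mult_mono) simp_all
      also have "\<dots> = d * (d * (d * (x * e)))"
        by (simp add: ac_simps)
      also have "\<dots> \<le> (P * (Q * (Q * (P * Q)))) $$ (i, j)"
        using trop_path_le_mult_mat5[OF mats(1,2,2,1,2) ij(1) ij(1) ij(1) ij(1) ij(2) ij(2)]
        by (simp add: diag x_def)
      finally show ?thesis .
    next
      case False
      have "(d * d) * (x * (e * e)) \<le> (e * e) * (x * (e * e))"
        using False by (intro trop_mult_mono) simp_all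
      also have "\<dots> = x * (e * (e * (e * e)))"
        by (simp add: ac_simps)
      also have "\<dots> \<le> (P * (Q * (Q * (P * Q)))) $$ (i, j)"
        using trop_path_le_mult_mat5[OF mats(1,2,2,1,2) ij(1) ij(2) ij(2) ij(2) ij(2) ij(2)]
        by (simp add: diag x_def)
      finally show ?thesis .
    qed
    then show "((P * Q) * (P * (P * Q))) $$ (i, j) \<le> ((P * Q) * (Q * (P * Q))) $$ (i, j)"
      unfolding x_def
      by (intro UT_middle_factor_le[OF PQ P Q PQ ij(1,2)])
        (erule (3) off_corner, simp only: PQ_diag assoc[OF mats(2)])
  next
    define y where "y = Q $$ (i, j)"
    \<comment> \<open>Here the jump must use a factor \<open>Q\<close>, the second or the fifth of
      \<open>PQPPQ\<close>. The fifth turns both \<open>e\<close> into \<open>d\<close>; the second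
      turns one \<open>d\<close> into \<open>e\<close>.\<close>
    have "(d * d) * (y * (e * e)) \<le> (P * (Q * (P * (P * Q)))) $$ (i, j)"
    proof (cases "e \<le> d")
      case True
      have "(d * d) * (y * (e * e)) \<le> (d * d) * (y * (d * d))"
        using True by (intro trop_mult_mono) simp_all
      also have "\<dots> = d * (d * (d * (d * y)))"
        by (simp add: ac_simps)
      also have "\<dots> \<le> (P * (Q * (P * (P * Q)))) $$ (i, j)"
        using trop_path_le_mult_mat5[OF mats(1,2,1,1,2) ij(1) ij(1) ij(1) ij(1) ij(1) ij(2)]
        by (simp add: diag y_def)
      finally show ?thesis .
    next
      case False
      have "(d * d) * (y * (e * e)) = d * (d * (y * (e * e)))"
        by (simp add: ac_simps)
      also have "\<dots> \<le> d * (e * (y * (e * e)))"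
        using False by (intro trop_mult_mono) simp_all
      also have "\<dots> = d * (y * (e * (e * e)))"
        by (simp add: ac_simps)
      also have "\<dots> \<le> (P * (Q * (P * (P * Q)))) $$ (i, j)"
        using trop_path_le_mult_mat5[OF mats(1,2,1,1,2) ij(1) ij(1) ij(2) ij(2) ij(2) ij(2)]
        by (simp add: diag y_def)
      finally show ?thesis .
    qed
    then show "((P * Q) * (Q * (P * Q))) $$ (i, j) \<le> ((P * Q) * (P * (P * Q))) $$ (i, j)"
      unfolding y_def
      by (intro UT_middle_factor_le[OF PQ Q P PQ ij(1,2)])
        (erule (3) off_corner[symmetric], simp only: PQ_diag assoc[OF mats(1)])
  qed
qed

section \<open>Evaluation of words\<close>

lemma (in monoid) eval_word_closed:
  assumes "range \<sigma> \<subseteq> carrier G"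
  shows "eval_word G \<sigma> w \<in> carrier G"
  using assms by (induction w) (auto simp: eval_word_def)

lemma (in monoid) eval_word_append:
  assumes "range \<sigma> \<subseteq> carrier G"
  shows "eval_word G \<sigma> (w @ w') = eval_word G \<sigma> w \<otimes> eval_word G \<sigma> w'"
proof (induction w)
  case Nil
  then show ?case
    using eval_word_closed[OF assms, of w'] by (simp add: eval_word_def)
next
  case (Cons a w)
  have "\<sigma> a \<in> carrier G" using assms by auto
  with Cons show ?case
    using eval_word_closed[OF assms, of w] eval_word_closed[OF assms, of w']
    by (simp add: eval_word_def m_assoc)
qed

text \<open>Induction on \<open>m\<close>, each step being \<open>UT_agree_step\<close>. For
  \<open>m = 0\<close> the entries on the diagonal agree by hypothesis, and those below it are
  \<open>0\<close>.\<close>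

lemma eval_u_word_v_word_agree:
  assumes \<sigma>: "range \<sigma> \<subseteq> carrier (UT n)"
    and diag: "\<And>i. i < n \<Longrightarrow> eval_word (UT n) \<sigma> p $$ (i, i) = eval_word (UT n) \<sigma> q $$ (i, i)"
    and "i < n" "j < n" "j \<le> i + m"
  shows "eval_word (UT n) \<sigma> (u_word m p q) $$ (i, j) = eval_word (UT n) \<sigma> (v_word m p q) $$ (i, j)"
  using assms(3-)
proof (induction m arbitrary: i j)
  case 0
  then show ?case
    using UT_entry_zero[OF monoid.eval_word_closed[OF monoid_UT \<sigma>]] diag by (cases "j < i") auto
next
  case (Suc m)
  define P where "P = eval_word (UT n) \<sigma> (u_word m p q)"
  define Q where "Q = eval_word (UT n) \<sigma> (v_word m p q)"
  have car: "P \<in> carrier (UT n)" "Q \<in> carrier (UT n)"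
    unfolding P_def Q_def by (rule monoid.eval_word_closed[OF monoid_UT \<sigma>])+
  have mats: "P \<in> carrier_mat n n" "Q \<in> carrier_mat n n"
    using car by (simp_all add: carrier_UT_iff)
  have assoc: "P * (Q * (C * (P * Q))) = (P * Q) * (C * (P * Q))" if "C \<in> carrier_mat n n" for C
    using that mats by (intro assoc_mult_mat[symmetric]) auto
  have "((P * Q) * (P * (P * Q))) $$ (i, j) = ((P * Q) * (Q * (P * Q))) $$ (i, j)"
    using Suc by (intro UT_agree_step[OF car, of m]) (auto simp: P_def Q_def)
  then show ?case
    using assoc[OF mats(1)] assoc[OF mats(2)]
    by (simp add: u1_word_def v1_word_def monoid.eval_word_append[OF monoid_UT \<sigma>]
        flip: P_def Q_def)
qed

theorem theorem4p2:
  fixes n :: nat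
  assumes "n \<ge> 1"
  shows "satisfies_identity (UT n) (u_word (n - 1) [X, Y] [Y, X]) (v_word (n - 1) [X, Y] [Y, X])"
  unfolding satisfies_identity_def
proof (intro allI impI)
  fix \<sigma> :: "var \<Rightarrow> trop mat"
  assume \<sigma>: "range \<sigma> \<subseteq> carrier (UT n)"
  then have car: "\<sigma> X \<in> carrier (UT n)" "\<sigma> Y \<in> carrier (UT n)"
    by auto
  have eval: "eval_word (UT n) \<sigma> [a, b] = \<sigma> a * \<sigma> b" for a b
  proof -
    have "\<sigma> b \<in> carrier (UT n)"
      using \<sigma> by auto
    then show ?thesis
      using monoid.r_one[OF monoid_UT, of "\<sigma> b" n] by (simp add: eval_word_def)
  qed
  have diag: "eval_word (UT n) \<sigma> [X, Y] $$ (i, i) = eval_word (UT n) \<sigma> [Y, X] $$ (i, i)"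
    if "i < n" for i
    using that car by (simp add: eval UT_mult_diag mult.commute)
  have mat: "eval_word (UT n) \<sigma> w \<in> carrier_mat n n" for w
    using monoid.eval_word_closed[OF monoid_UT \<sigma>, of w] by (simp add: carrier_UT_iff)
  show "eval_word (UT n) \<sigma> (u_word (n - 1) [X, Y] [Y, X])
      = eval_word (UT n) \<sigma> (v_word (n - 1) [X, Y] [Y, X])"
    \<comment> \<open>With \<open>m = n - 1\<close> the bound \<open>j \<le> i + m\<close> holds for
      every \<open>j < n\<close>, so the agreement covers the whole matrix.\<close>
    by (intro eq_matI)
      (auto simp: carrier_matD[OF mat] intro!: eval_u_word_v_word_agree[OF \<sigma> diag])
qed

end
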